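(* For all real $n>2$ and all finite $T>0$, $$\left[\frac{\partial\tilde\tau_T(n,\beta)}{\partial\beta}\right]_{\beta=1/2}=0 .$$ Furthermore, within the open intervals where the trajectory avoids integer values of the parameter (i.e. where $\tilde\tau_T(n,\beta)$ is not an integer), all odd-ordered partial derivatives with respect to $\beta$ vanish at $\beta=1/2$: $$\left[\frac{\partial^{2m+1}\tilde\tau_T(n,\beta)}{\partial\beta^{2m+1}}\right]_{\beta=1/2}=0\qquad\text{for all } m\in\mathbb{N}_0 .$$
   Context: Septic parametric logarithmic operator: for real $n>1$ and real $\tau\in\mathbb{R}^+$, with $k=\lfloor\tau\rfloor$, $$\operatorname{li}(n;\tau)=\frac{n}{\ln n}\left(\sum_{j=0}^{k-1}\frac{j!}{\ln^j n}+\phi(\tau-\lfloor\tau\rfloor)\frac{k!}{\ln^k n}\right),\qquad \phi(x)=35x^4-84x^5+70x^6-20x^7 ,$$ with the empty sum equal to $0$. Let $0<\gamma_1\le\gamma_2\le\cdots$ be the positive imaginary parts of the non-trivial zeros of the Riemann zeta function. $\Phi(\gamma;T)$ is a smooth ($C^\infty$) window function with $\Phi=1$ for $\gamma\le T-\epsilon$ and $\Phi=0$ for $\gamma\ge T+\epsilon$ ($\epsilon>0$ fixed). Generalized truncation function: for $(n,T,\beta)\in(1,\infty)\times\mathbb{R}^+\times(0,1)$, $\tilde\tau_T(n,\beta)$ is the unique real root of $\operatorname{li}(n;\tilde\tau_T(n,\beta))=\widetilde{\mathcal{R}}_T(n,\beta)$, where $$\widetilde{\mathcal{R}}_T(n,\beta)=\sum_{k=1}^{\lfloor\log_2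 n\rfloor}\frac{\mu(k)}{k}\Bigg[\operatorname{li}(n^{1/k})-\ln2+\int_{n^{1/k}}^\infty\frac{du}{u(u^2-1)\ln u}-\frac12\sum_{\gamma_j>0}\Phi(\gamma_j;T)\,E_{j,k}(n,\beta)\Bigg],$$ $$E_{j,k}(n,\beta)=\operatorname{Ei}\left(\tfrac{\beta+i\gamma_j}{k}\ln n\right)+\operatorname{Ei}\left(\tfrac{\beta-i\gamma_j}{k}\ln n\right)+\operatorname{Ei}\left(\tfrac{(1-\beta)+i\gamma_j}{k}\ln n\right)+\operatorname{Ei}\left(\tfrac{(1-\beta)-i\gamma_j}{k}\ln n\right).$$ Here $\operatorname{li}(x)$ with a single argument is the ordinary logarithmic integral, $\mu$ the Möbius function, and $\operatorname{Ei}$ the principal branch of the exponential integral.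
   Formalization: If the root at β=1/2 is an integer, the first derivative may not exist (cusp); there it is only shown that it is 0 if it exists. Existence and value 0 are proved when the root is not an integer. Where no positive root exists, the truncation function is set to 0. *)

theory Defs
  imports
    "HOL-Complex_Analysis.Complex_Analysis"
    "HOL-Computational_Algebra.Computational_Algebra"
begin

(* Meant for open S, where the iterated derivatives are genuine. *)
definition smooth_on :: "real set \<Rightarrow> (real \<Rightarrow> real) \<Rightarrow> bool" where
  "smooth_on S f \<longleftrightarrow> (\<forall>k. \<forall>x\<in>S. (deriv ^^ k) f differentiable (at x))"

definition moebius :: "nat \<Rightarrow> int" where
  "moebius k = (if squarefree k then (-1) ^ card (prime_factors k) else 0)"

(* The analytic continuation of the Dirichlet series to the plane without 1, which exists and is
   unique by classical theorems. The value 0 at the pole is a convention that makes the description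
   definite. *)
definition riemann_zeta :: "complex \<Rightarrow> complex" where
  "riemann_zeta = (THE f. f holomorphic_on - {1} \<and> f 1 = 0 \<and>
     (\<forall>s. Re s > 1 \<longrightarrow> f s = (\<Sum>m. 1 / of_nat (Suc m) powr s)))"

definition nontrivial_zeros :: "complex set" where
  "nontrivial_zeros = {\<rho>. riemann_zeta \<rho> = 0 \<and> 0 < Re \<rho> \<and> Re \<rho> < 1}"

definition zero_count :: "real \<Rightarrow> nat" where
  "zero_count t =
     (\<Sum>\<rho>\<in>{\<rho> \<in> nontrivial_zeros. 0 < Im \<rho> \<and> Im \<rho> \<le> t}. nat (zorder riemann_zeta \<rho>))"

(* For j = 1, 2, ... this is the nondecreasing list of the positive imaginary parts of the
   nontrivial zeros, each repeated according to multiplicity. The index 0 is not used. *)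
definition zero_ordinate :: "nat \<Rightarrow> real" where
  "zero_ordinate j = Inf {t. j \<le> zero_count t}"

(* Principal branch: Ln is the principal logarithm, and the remaining series is entire. *)
definition Ei :: "complex \<Rightarrow> complex" where
  "Ei z = euler_mascheroni + Ln z + (\<Sum>m. z ^ Suc m / (of_nat (Suc m) * fact (Suc m)))"

(* Cauchy principal value of the integral of 1 / ln t over (0, x), for x > 1. *)
definition log_integral :: "real \<Rightarrow> real" where
  "log_integral x = Lim (at_right 0)
     (\<lambda>d. integral {0..1 - d} (\<lambda>t. 1 / ln t) + integral {1 + d..x} (\<lambda>t. 1 / ln t))"

definition septic_step :: "real \<Rightarrow> real" where
  "septic_step x = 35 * x ^ 4 - 84 * x ^ 5 + 70 * x ^ 6 - 20 * x ^ 7"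

definition septic_li :: "real \<Rightarrow> real \<Rightarrow> real" where
  "septic_li n \<tau> = (let k = nat \<lfloor>\<tau>\<rfloor> in
     n / ln n * ((\<Sum>j<k. fact j / ln n ^ j) + septic_step (\<tau> - of_int \<lfloor>\<tau>\<rfloor>) * (fact k / ln n ^ k)))"

definition smooth_window :: "real \<Rightarrow> (real \<Rightarrow> real \<Rightarrow> real) \<Rightarrow> bool" where
  "smooth_window \<epsilon> \<Phi> \<longleftrightarrow> (\<forall>T>0.
     smooth_on UNIV (\<lambda>\<gamma>. \<Phi> \<gamma> T) \<and>
     (\<forall>\<gamma>. \<gamma> \<le> T - \<epsilon> \<longrightarrow> \<Phi> \<gamma> T = 1) \<and> (\<forall>\<gamma>. \<gamma> \<ge> T + \<epsilon> \<longrightarrow> \<Phi> \<gamma> T = 0))"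

definition zero_term :: "real \<Rightarrow> nat \<Rightarrow> real \<Rightarrow> real \<Rightarrow> complex" where
  "zero_term \<gamma> k n \<beta> =
     Ei (Complex \<beta> \<gamma> / of_nat k * of_real (ln n)) +
     Ei (Complex \<beta> (- \<gamma>) / of_nat k * of_real (ln n)) +
     Ei (Complex (1 - \<beta>) \<gamma> / of_nat k * of_real (ln n)) +
     Ei (Complex (1 - \<beta>) (- \<gamma>) / of_nat k * of_real (ln n))"

(* The sum over j runs over the indices at which the window does not vanish. There are finitely
   many of them, because a bounded part of the critical strip contains finitely many zeros. *)
definition truncated_R ::
    "(real \<Rightarrow> real \<Rightarrow> real) \<Rightarrow> real \<Rightarrow> real \<Rightarrow> real \<Rightarrow> complex" where
  "truncated_R \<Phi> T n \<beta> =
     (\<Sum>k = 1..nat \<lfloor>log 2 n\<rfloor>. of_int (moebius k) / of_nat k *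
        (of_real (log_integral (n powr (1 / real k)) - ln 2
           + integral {n powr (1 / real k)..} (\<lambda>u. 1 / (u * (u\<^sup>2 - 1) * ln u)))
         - 1 / 2 * (\<Sum>j\<in>{j. 1 \<le> j \<and> \<Phi> (zero_ordinate j) T \<noteq> 0}.
             of_real (\<Phi> (zero_ordinate j) T) * zero_term (zero_ordinate j) k n \<beta>)))"

definition is_trunc_root ::
    "(real \<Rightarrow> real \<Rightarrow> real) \<Rightarrow> real \<Rightarrow> real \<Rightarrow> real \<Rightarrow> real \<Rightarrow> bool" where
  "is_trunc_root \<Phi> T n \<beta> \<tau> \<longleftrightarrow>
     \<tau> > 0 \<and> complex_of_real (septic_li n \<tau>) = truncated_R \<Phi> T n \<beta>"

(* For n > 1, septic_li n maps the positive reals strictly increasingly onto the positive reals, so a root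
   exists exactly when the right-hand side is positive. Where there is none, the value is set to 0;
   being an integer, it does not count as a point where the trajectory avoids the integers. *)
definition trunc_tau ::
    "(real \<Rightarrow> real \<Rightarrow> real) \<Rightarrow> real \<Rightarrow> real \<Rightarrow> real \<Rightarrow> real" where
  "trunc_tau \<Phi> T n \<beta> =
     (if \<exists>!\<tau>. is_trunc_root \<Phi> T n \<beta> \<tau> then THE \<tau>. is_trunc_root \<Phi> T n \<beta> \<tau> else 0)"

end

theory Submission
  imports Defs
begin

(* The four exponential integrals of each zero are permuted by \<beta> \<mapsto> 1 - \<beta>, so the truncated
   counting function, and with it the root, is symmetric about 1/2; hence every odd derivative that
   exists at 1/2 vanishes. For smoothness near 1/2, observe that the truncated counting function
   extends holomorphically in \<beta> to the critical strip, while between consecutive integers septic_li is an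
   affine image of a polynomial with nonzero derivative. The root is therefore the restriction of a
   local holomorphic inverse branch, which commutes with conjugation and so is real on the reals. *)

section \<open>Derivatives of restrictions and of symmetric functions\<close>

text \<open>Along the real axis the complex derivative is the real one, and taking real parts
  commutes with it; induction on \<open>k\<close> then matches the iterated derivatives. Stating a
  genuine derivative at every order is the form that \<open>smooth_on\<close> asks for.\<close>

lemma deriv_funpow_Re_holomorphic:
  fixes f :: "real \<Rightarrow> real" and h :: "complex \<Rightarrow> complex"
  assumes "open A" "open S" "h holomorphic_on S"
    and sub: "\<And>x. x \<in> A \<Longrightarrow> of_real x \<in> S"
    and eq: "\<And>x. x \<in> A \<Longrightarrow> f x = Re (h (of_real x))"
    and "x \<in> A"
  shows "((deriv ^^ k) f has_real_derivative Re ((deriv ^^ Suc k) h (of_real x))) (at x)"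
proof -
  \<comment> \<open>\<open>F\<close> is kept general: the induction and the final claim both apply
    this to \<open>F = (deriv ^^ k) f\<close>, once its values on \<open>A\<close> are
    known.\<close>
  have step: "(F has_real_derivative Re ((deriv ^^ Suc k) h (of_real x))) (at x)"
    if "\<And>x. x \<in> A \<Longrightarrow> F x = Re ((deriv ^^ k) h (of_real x))" "x \<in> A" for F :: "real \<Rightarrow> real" and k x
  proof -
    have "(deriv ^^ k) h holomorphic_on S"
      using assms by (intro holomorphic_higher_deriv)
    then have "((deriv ^^ k) h has_field_derivative (deriv ^^ Suc k) h (of_real x)) (at (of_real x))"
      using holomorphic_derivI[of "(deriv ^^ k) h" S] \<open>open S\<close> sub that(2) by simp
    then have "((\<lambda>x. Re ((deriv ^^ k) h (of_real x))) has_real_derivative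
        Re ((deriv ^^ Suc k) h (of_real x))) (at x)"
      by (intro has_field_derivative_Re has_vector_derivative_real_field)
    then show ?thesis
      by (rule has_field_derivative_transform_within_open[OF _ \<open>open A\<close> that(2)]) (simp add: that(1))
  qed
  have "(deriv ^^ k) f x = Re ((deriv ^^ k) h (of_real x))" if "x \<in> A" for x
    using that
  proof (induction k arbitrary: x)
    case (Suc k)
    then show ?case
      using DERIV_imp_deriv[OF step[OF Suc.IH Suc.prems]] by simp
  qed (simp add: eq)
  from step[OF this \<open>x \<in> A\<close>] show ?thesis .
qed

lemma smooth_on_Re_holomorphic:
  fixes f :: "real \<Rightarrow> real" and h :: "complex \<Rightarrow> complex"
  assumes "open A" "open S" "h holomorphic_on S"
    and "\<And>x. x \<in> A \<Longrightarrow> of_real x \<in> S"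
    and "\<And>x. x \<in> A \<Longrightarrow> f x = Re (h (of_real x))"
  shows "smooth_on A f"
  unfolding smooth_on_def
  using deriv_funpow_Re_holomorphic[OF assms] real_differentiable_def by blast

lemma has_real_derivative_reflect:
  fixes f :: "real \<Rightarrow> real"
  assumes "(f has_real_derivative D) (at (c - x))"
  shows "((\<lambda>x. f (c - x)) has_real_derivative - D) (at x)"
proof -
  have "((-) c has_real_derivative - 1) (at x)"
    by (auto intro!: derivative_eq_intros)
  from DERIV_chain2[where f = f and g = "(-) c", OF assms this] show ?thesis by simp
qed

lemma symmetric_derivative_zero:
  fixes f :: "real \<Rightarrow> real"
  assumes "\<And>x. f (2 * c - x) = f x" "(f has_real_derivative D) (at c)"
  shows "D = 0"
proof -
  have "(f has_real_derivative - D) (at c)"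
    using has_real_derivative_reflect[of f D "2 * c" c] assms by simp
  then have "D = - D"
    using assms(2) DERIV_unique by blast
  then show ?thesis by simp
qed

text \<open>Each differentiation of the reflection identity contributes one factor -1 from the inner
  function. The interval is centred at \<open>c\<close>, so reflected points remain where
  \<open>f\<close> is smooth.\<close>

lemma deriv_funpow_symmetric:
  fixes f :: "real \<Rightarrow> real"
  assumes sym: "\<And>x. f (2 * c - x) = f x" and smooth: "smooth_on {c - r<..<c + r} f"
    and "x \<in> {c - r<..<c + r}"
  shows "(deriv ^^ k) f (2 * c - x) = (- 1) ^ k * (deriv ^^ k) f x"
  using \<open>x \<in> {c - r<..<c + r}\<close>
proof (induction k arbitrary: x)
  case (Suc k)
  let ?g = "(deriv ^^ k) f"
  have d: "(?g has_real_derivative deriv ?g y) (at y)" if "y \<in> {c - r<..<c + r}" for y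
    using smooth that unfolding smooth_on_def by (simp add: DERIV_deriv_iff_real_differentiable)
  have "2 * c - x \<in> {c - r<..<c + r}"
    using Suc.prems by auto
  then have "((\<lambda>y. ?g (2 * c - y)) has_real_derivative - deriv ?g (2 * c - x)) (at x)"
    by (intro has_real_derivative_reflect d)
  then have "((\<lambda>y. (- 1) ^ k * ?g y) has_real_derivative - deriv ?g (2 * c - x)) (at x)"
    by (rule has_field_derivative_transform_within_open[OF _ open_greaterThanLessThan Suc.prems])
      (rule Suc.IH)
  moreover have "((\<lambda>y. (- 1) ^ k * ?g y) has_real_derivative (- 1) ^ k * deriv ?g x) (at x)"
    by (intro DERIV_cmult d Suc.prems)
  ultimately have "- deriv ?g (2 * c - x) = (- 1) ^ k * deriv ?g x"
    by (rule DERIV_unique)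
  then show ?case by simp
qed (simp add: sym)

lemma odd_deriv_funpow_symmetric:
  fixes f :: "real \<Rightarrow> real"
  assumes "\<And>x. f (2 * c - x) = f x" "smooth_on {c - r<..<c + r} f" "r > 0" "odd k"
  shows "(deriv ^^ k) f c = 0"
  using deriv_funpow_symmetric[OF assms(1,2), where x = c and k = k] assms(3,4) by simp

section \<open>Inverse branches that are real on the reals\<close>

text \<open>The branch is h = g o q, with g a local inverse of p near c. It is real on the reals: if
  p w is real, then w and its conjugate have the same image and both lie in the ball with real
  centre c, so injectivity makes them equal.\<close>

lemma real_holomorphic_inverse_branch:
  fixes p q :: "complex \<Rightarrow> complex" and b c :: real
  assumes p: "p holomorphic_on UNIV" "\<And>z. p (cnj z) = cnj (p z)" "deriv p (of_real c) \<noteq> 0"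
    and q: "q holomorphic_on S" "open S" "of_real b \<in> S" "\<And>x. of_real x \<in> S \<Longrightarrow> q (of_real x) \<in> \<real>"
    and eq: "q (of_real b) = p (of_real c)"
  obtains r h where "r > 0" "h holomorphic_on ball (of_real b) r"
    "h (of_real b) = of_real c" "\<And>z. z \<in> ball (of_real b) r \<Longrightarrow> p (h z) = q z"
    "\<And>x. complex_of_real x \<in> ball (of_real b) r \<Longrightarrow> h (of_real x) \<in> \<real>"
proof -
  obtain s where s: "s > 0" "open (p ` ball (of_real c) s)" "inj_on p (ball (of_real c) s)"
    using has_complex_derivative_locally_invertible[OF p(1) UNIV_I open_UNIV p(3)] by metis
  define B where "B = ball (complex_of_real c) s"
  have cB: "of_real c \<in> B" using s(1) by (simp add: B_def)
  have "p holomorphic_on B" using p(1) holomorphic_on_subset by blast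
  then obtain g where g: "g holomorphic_on p ` B" "\<And>z. z \<in> B \<Longrightarrow> g (p z) = z"
    using holomorphic_has_inverse[of p B] s(3) unfolding B_def by (metis open_ball)
  have "continuous_on S q" using q(1) holomorphic_on_imp_continuous_on by blast
  \<comment> \<open>By continuity, q maps a small ball around b into the domain of the local
    inverse.\<close>
  then have "open (q -` (p ` B) \<inter> S)"
    using continuous_on_open_vimage[OF q(2)] s(2) unfolding B_def by blast
  moreover have "of_real b \<in> q -` (p ` B) \<inter> S" using q(3) eq cB by auto
  ultimately obtain r where r: "r > 0" "ball (of_real b) r \<subseteq> q -` (p ` B) \<inter> S"
    by (meson open_contains_ball)
  show ?thesis
  proof
    show "r > 0" by fact
    show "(\<lambda>z. g (q z)) holomorphic_on ball (of_real b) r"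
      using holomorphic_on_compose_gen[of q "ball (of_real b) r" g "p ` B"] g(1) q(1) r(2)
      by (auto simp: o_def intro: holomorphic_on_subset)
    show "g (q (of_real b)) = of_real c" using g(2) cB eq by simp
    show "p (g (q z)) = q z" if "z \<in> ball (of_real b) r" for z
      using r(2) that g(2) by fastforce
    show "g (q (of_real x)) \<in> \<real>" if x: "complex_of_real x \<in> ball (of_real b) r" for x
    proof -
      have "q (of_real x) \<in> p ` B" using subsetD[OF r(2) x] by simp
      then obtain w where w: "w \<in> B" "q (of_real x) = p w" by blast
      have "dist (of_real c) (cnj w) = dist (of_real c) w"
        by (metis complex_cnj_complex_of_real complex_cnj_diff complex_mod_cnj dist_norm)
      then have "cnj w \<in> B" using w(1) by (simp add: B_def)
      moreover have "p (cnj w) = p w"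
        using q(4)[of x] r(2) x w(2) p(2) by (metis IntD2 Reals_cnj_iff subsetD)
      ultimately have "cnj w = w" using s(3) w(1) unfolding B_def by (metis inj_onD)
      then show ?thesis using g(2) w by (simp add: Reals_cnj_iff)
    qed
  qed
qed

section \<open>The septic operator\<close>

text \<open>The factored form shows positivity on the open unit interval and triple zeros at 0 and
  1. These zeros are why the inverse branch is built only at non-integer parameters.\<close>

lemma septic_step_has_derivative:
  "(septic_step has_real_derivative 140 * (x * (1 - x)) ^ 3) (at x)"
  unfolding septic_step_def [abs_def]
  by (rule derivative_eq_intros refl | simp)+ algebra

lemma septic_step_strict_mono:
  assumes "0 \<le> x" "x < y" "y \<le> 1"
  shows "septic_step x < septic_step y"
\<comment> \<open>The derivative may vanish at the ends, so positivity is required only strictly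
  between them.\<close>
proof (rule DERIV_pos_imp_increasing_open[OF \<open>x < y\<close>])
  fix z assume "x < z" "z < y"
  then have "140 * (z * (1 - z)) ^ 3 > 0" using assms by simp
  then show "\<exists>d. (septic_step has_real_derivative d) (at z) \<and> d > 0"
    using septic_step_has_derivative by blast
next
  show "continuous_on {x..y} septic_step"
    using septic_step_has_derivative DERIV_isCont continuous_at_imp_continuous_on by blast
qed

lemma septic_step_0 [simp]: "septic_step 0 = 0" and septic_step_1 [simp]: "septic_step 1 = 1"
  by (simp_all add: septic_step_def)

text \<open>As the parameter crosses [k, k + 1), the bracket climbs from the partial sum of k terms
  towards that of k + 1 terms, so the pieces fit together monotonically.\<close>

lemma septic_li_strict_mono:
  assumes "n > 1" "0 \<le> s" "s < t"
  shows "septic_li n s < septic_li n t"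
proof -
  define k l where "k = nat \<lfloor>s\<rfloor>" and "l = nat \<lfloor>t\<rfloor>"
  define a where "a j = fact j / ln n ^ j" for j
  have a: "a j > 0" for j using \<open>n > 1\<close> by (simp add: a_def)
  define x y where "x = s - of_int \<lfloor>s\<rfloor>" and "y = t - of_int \<lfloor>t\<rfloor>"
  have xy: "0 \<le> x" "x < 1" "0 \<le> y" "y < 1"
    unfolding x_def y_def by linarith+
  have st: "s = real k + x" "t = real l + y"
    using assms by (simp_all add: k_def l_def x_def y_def)
  have lt: "(\<Sum>j<k. a j) + septic_step x * a k < (\<Sum>j<l. a j) + septic_step y * a l"
  proof (cases "k = l")
    case True
    then have "septic_step x < septic_step y"
      using st assms(3) xy by (intro septic_step_strict_mono) auto
    then show ?thesis using True a by simp
  next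
    case False
    then have "k < l" using st xy assms(3) by linarith
    \<comment> \<open>Since x < 1, the value at s stays strictly below the full sum through index k,
      which is already contained in the sum for t.\<close>
    have "(\<Sum>j<k. a j) + septic_step x * a k < (\<Sum>j<Suc k. a j)"
      using septic_step_strict_mono[of x 1] xy a[of k] by simp
    also have "\<dots> \<le> (\<Sum>j<l. a j)"
      using \<open>k < l\<close> a by (intro sum_mono2) (auto simp: less_imp_le)
    also have "\<dots> \<le> (\<Sum>j<l. a j) + septic_step y * a l"
      using septic_step_strict_mono[of 0 y] xy a[of l] by (cases "y = 0") auto
    finally show ?thesis .
  qed
  have "septic_li n s = n / ln n * ((\<Sum>j<k. a j) + septic_step x * a k)"
    "septic_li n t = n / ln n * ((\<Sum>j<l. a j) + septic_step y * a l)"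
    by (simp_all add: septic_li_def Let_def k_def l_def x_def y_def a_def)
  moreover have "n / ln n > 0" using \<open>n > 1\<close> by simp
  ultimately show ?thesis using lt by (simp only: mult_strict_left_mono)
qed

text \<open>Freezing the integer part leaves a polynomial in \<open>t\<close>, which can be
  continued to complex arguments.\<close>

lemma septic_li_on_unit_interval:
  assumes "of_nat k < t" "t < of_nat k + 1"
  shows "septic_li n t = n / ln n * ((\<Sum>j<k. fact j / ln n ^ j) + septic_step (t - of_nat k) * (fact k / ln n ^ k))"
proof -
  have "\<lfloor>t\<rfloor> = int k" using assms by linarith
  then show ?thesis by (simp add: septic_li_def)
qed

section \<open>The truncated counting function\<close>

lemma summable_Ei_series:
  fixes z :: complex
  shows "summable (\<lambda>m. 1 / (of_nat (Suc m) * fact (Suc m)) * z ^ m)"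
proof (rule summable_comparison_test')
  \<comment> \<open>The dominating series is the exponential series at
    \<open>norm z\<close>.\<close>
  show "summable (\<lambda>m. norm z ^ m / fact m)"
    using summable_exp[of "norm z"] by (simp add: field_simps)
  fix m :: nat
  have "fact m * 1 \<le> (fact (Suc m) * real (Suc m))"
    by (intro mult_mono fact_mono) auto
  then show "norm (1 / (of_nat (Suc m) * fact (Suc m)) * z ^ m) \<le> norm z ^ m / fact m"
    by (auto simp: norm_mult norm_divide norm_power mult.commute simp del: fact_Suc of_nat_Suc
        intro!: divide_left_mono)
qed

lemma Ei_series_eq:
  fixes z :: complex
  shows "(\<Sum>m. z ^ Suc m / (of_nat (Suc m) * fact (Suc m))) =
    z * (\<Sum>m. 1 / (of_nat (Suc m) * fact (Suc m)) * z ^ m)"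
  using suminf_mult[OF summable_Ei_series[of z], of z]
  by (simp add: field_simps del: fact_Suc of_nat_Suc)

text \<open>The series part is an everywhere convergent power series times z; the right half-plane
  keeps \<open>Ln\<close> off its branch cut.\<close>

lemma Ei_holomorphic: "Ei holomorphic_on {z. Re z > 0}"
proof -
  let ?d = "\<lambda>m. 1 / (of_nat (Suc m) * fact (Suc m)) :: complex"
  have "(\<lambda>z. \<Sum>m. ?d m * z ^ m) field_differentiable at z" for z
    using termdiffs_strong_converges_everywhere[of ?d z, OF summable_Ei_series]
    unfolding field_differentiable_def by blast
  then have "(\<lambda>z. \<Sum>m. ?d m * z ^ m) holomorphic_on UNIV"
    by (simp add: holomorphic_on_def field_differentiable_at_within)
  then have "(\<lambda>z. \<Sum>m. ?d m * z ^ m) holomorphic_on {z. Re z > 0}"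
    by (rule holomorphic_on_subset) simp
  then show ?thesis
    unfolding Ei_def [abs_def] Ei_series_eq
    by (intro holomorphic_intros) (auto simp: complex_nonpos_Reals_iff)
qed

text \<open>The power series has real coefficients, Euler's constant is real, and off the cut
  \<open>Ln\<close> commutes with conjugation.\<close>

lemma Ei_cnj:
  assumes "Re z > 0"
  shows "Ei (cnj z) = cnj (Ei z)"
proof -
  let ?d = "\<lambda>m. 1 / (of_nat (Suc m) * fact (Suc m)) :: complex"
  have "(\<lambda>m. cnj (?d m * z ^ m)) sums cnj (\<Sum>m. ?d m * z ^ m)"
    using summable_Ei_series[of z] by (simp only: sums_cnj summable_sums)
  then have "(\<Sum>m. ?d m * cnj z ^ m) = cnj (\<Sum>m. ?d m * z ^ m)"
    by (simp add: sums_iff del: fact_Suc of_nat_Suc)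
  moreover have "Ln (cnj z) = cnj (Ln z)"
    using assms by (intro cnj_Ln[symmetric]) (auto simp: complex_nonpos_Reals_iff)
  moreover have "cnj euler_mascheroni = euler_mascheroni"
    by (metis of_real_euler_mascheroni complex_cnj_complex_of_real)
  ultimately show ?thesis
    unfolding Ei_def Ei_series_eq by (simp del: fact_Suc of_nat_Suc)
qed

section \<open>Continuation of the zero terms and of the counting function in \<beta>\<close>

definition zero_term_ext :: "real \<Rightarrow> nat \<Rightarrow> real \<Rightarrow> complex \<Rightarrow> complex" where
  "zero_term_ext \<gamma> k n z =
     Ei ((z + \<i> * of_real \<gamma>) / of_nat k * of_real (ln n)) +
     Ei ((z - \<i> * of_real \<gamma>) / of_nat k * of_real (ln n)) +
     Ei ((1 - z + \<i> * of_real \<gamma>) / of_nat k * of_real (ln n)) +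
     Ei ((1 - z - \<i> * of_real \<gamma>) / of_nat k * of_real (ln n))"

text \<open>\<open>Complex\<close> accepts only real components, so the extension writes its
  arguments as sums with \<i> * \<gamma>; at real points the two notations agree.\<close>

lemma zero_term_ext_of_real: "zero_term_ext \<gamma> k n (of_real \<beta>) = zero_term \<gamma> k n \<beta>"
proof -
  have "complex_of_real \<beta> + \<i> * of_real \<gamma> = Complex \<beta> \<gamma>"
    "complex_of_real \<beta> - \<i> * of_real \<gamma> = Complex \<beta> (- \<gamma>)"
    "1 - complex_of_real \<beta> + \<i> * of_real \<gamma> = Complex (1 - \<beta>) \<gamma>"
    "1 - complex_of_real \<beta> - \<i> * of_real \<gamma> = Complex (1 - \<beta>) (- \<gamma>)"
    by (simp_all add: complex_eq_iff)
  then show ?thesis by (simp only: zero_term_ext_def zero_term_def)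
qed

definition critical_strip :: "complex set" where
  "critical_strip = {z. 0 < Re z \<and> Re z < 1}"

lemma open_critical_strip: "open critical_strip"
  unfolding critical_strip_def
  by (intro open_Collect_conj open_halfspace_Re_gt open_halfspace_Re_lt)

text \<open>In the strip both z and 1 - z have positive real part. Adding imaginary numbers and
  scaling by \<open>ln n / k > 0\<close> preserve this, so all four arguments stay where
  \<open>Ei\<close> is holomorphic.\<close>

lemma zero_term_ext_holomorphic:
  assumes "n > 1" "k > 0"
  shows "zero_term_ext \<gamma> k n holomorphic_on critical_strip"
proof -
  have E: "(\<lambda>z. Ei (f z / of_nat k * of_real (ln n))) holomorphic_on critical_strip"
    if "f holomorphic_on critical_strip" "\<And>z. z \<in> critical_strip \<Longrightarrow> Re (f z) > 0" for f
  proof -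
    have "(\<lambda>z. f z / of_nat k * of_real (ln n)) holomorphic_on critical_strip"
      using assms that(1) by (intro holomorphic_intros) auto
    moreover have "(\<lambda>z. f z / of_nat k * of_real (ln n)) ` critical_strip \<subseteq> {z. Re z > 0}"
      using assms that(2) by (auto simp: Re_divide_of_nat)
    ultimately show ?thesis
      using holomorphic_on_compose_gen[OF _ Ei_holomorphic] by (simp add: o_def)
  qed
  show ?thesis
    unfolding zero_term_ext_def [abs_def]
    by (intro holomorphic_on_add E holomorphic_intros) (auto simp: critical_strip_def)
qed

text \<open>The four values form two complex conjugate pairs.\<close>

lemma zero_term_real:
  assumes "n > 1" "k > 0" "0 < \<beta>" "\<beta> < 1"
  shows "zero_term \<gamma> k n \<beta> \<in> \<real>"
proof -
  have "cnj (Ei (Complex b g / of_nat k * of_real (ln n))) = Ei (Complex b (- g) / of_nat k * of_real (ln n))"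
    if "b > 0" for b g
    using Ei_cnj[of "Complex b g / of_nat k * of_real (ln n)"] that assms(1,2)
    by (simp add: Re_divide_of_nat complex_cnj)
  then have "cnj (zero_term \<gamma> k n \<beta>) = zero_term \<gamma> k n \<beta>"
    using assms(3,4) by (simp add: zero_term_def)
  then show ?thesis by (simp add: Reals_cnj_iff)
qed

definition truncated_R_ext ::
    "(real \<Rightarrow> real \<Rightarrow> real) \<Rightarrow> real \<Rightarrow> real \<Rightarrow> complex \<Rightarrow> complex" where
  "truncated_R_ext \<Phi> T n z =
     (\<Sum>k = 1..nat \<lfloor>log 2 n\<rfloor>. of_int (moebius k) / of_nat k *
        (of_real (log_integral (n powr (1 / real k)) - ln 2
           + integral {n powr (1 / real k)..} (\<lambda>u. 1 / (u * (u\<^sup>2 - 1) * ln u)))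
         - 1 / 2 * (\<Sum>j\<in>{j. 1 \<le> j \<and> \<Phi> (zero_ordinate j) T \<noteq> 0}.
             of_real (\<Phi> (zero_ordinate j) T) * zero_term_ext (zero_ordinate j) k n z)))"

lemma truncated_R_ext_of_real: "truncated_R_ext \<Phi> T n (of_real \<beta>) = truncated_R \<Phi> T n \<beta>"
  by (simp only: truncated_R_ext_def truncated_R_def zero_term_ext_of_real)

lemma truncated_R_ext_holomorphic:
  assumes "n > 1"
  shows "truncated_R_ext \<Phi> T n holomorphic_on critical_strip"
  unfolding truncated_R_ext_def [abs_def]
  by (intro holomorphic_on_sum holomorphic_intros zero_term_ext_holomorphic assms) auto

lemma truncated_R_real:
  assumes "n > 1" "0 < \<beta>" "\<beta> < 1"
  shows "truncated_R \<Phi> T n \<beta> \<in> \<real>"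
  unfolding truncated_R_def
  by (intro sum_in_Reals Reals_mult Reals_diff Reals_divide zero_term_real assms) auto

lemma truncated_R_symmetric: "truncated_R \<Phi> T n (1 - \<beta>) = truncated_R \<Phi> T n \<beta>"
proof -
  have "zero_term \<gamma> k n (1 - \<beta>) = zero_term \<gamma> k n \<beta>" for \<gamma> k
    by (simp add: zero_term_def)
  then show ?thesis by (simp only: truncated_R_def)
qed

section \<open>The truncation function\<close>

text \<open>The root predicates at \<beta> and 1 - \<beta> are equal as functions, so the
  description agrees, and so does the default 0 when there is no root.\<close>

lemma trunc_tau_symmetric: "trunc_tau \<Phi> T n (1 - \<beta>) = trunc_tau \<Phi> T n \<beta>"
proof -
  have "is_trunc_root \<Phi> T n (1 - \<beta>) = is_trunc_root \<Phi> T n \<beta>"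
    by (simp add: is_trunc_root_def [abs_def] truncated_R_symmetric)
  then show ?thesis by (simp only: trunc_tau_def)
qed

text \<open>Strict monotonicity of \<open>septic_li\<close> allows only one positive root, so
  exhibiting a root fixes the value.\<close>

lemma trunc_tau_eqI:
  assumes "n > 1" "is_trunc_root \<Phi> T n \<beta> \<tau>"
  shows "trunc_tau \<Phi> T n \<beta> = \<tau>"
proof -
  have "\<sigma> = \<tau>" if "is_trunc_root \<Phi> T n \<beta> \<sigma>" for \<sigma>
  proof -
    have "complex_of_real (septic_li n \<sigma>) = of_real (septic_li n \<tau>)" "\<sigma> > 0" "\<tau> > 0"
      using assms(2) that by (simp_all add: is_trunc_root_def)
    then show ?thesis
      using septic_li_strict_mono[OF assms(1), of \<sigma> \<tau>] septic_li_strict_mono[OF assms(1), of \<tau> \<sigma>]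
      by (cases \<sigma> \<tau> rule: linorder_cases) auto
  qed
  then have "\<exists>!\<tau>. is_trunc_root \<Phi> T n \<beta> \<tau>" "(THE \<tau>. is_trunc_root \<Phi> T n \<beta> \<tau>) = \<tau>"
    using assms(2) by blast+
  then show ?thesis by (simp add: trunc_tau_def)
qed

text \<open>The default value 0 is an integer, so a non-integer value must come from an actual
  root.\<close>

lemma is_trunc_root_trunc_tau:
  assumes "trunc_tau \<Phi> T n \<beta> \<notin> \<int>"
  shows "is_trunc_root \<Phi> T n \<beta> (trunc_tau \<Phi> T n \<beta>)"
proof -
  have "\<exists>!\<tau>. is_trunc_root \<Phi> T n \<beta> \<tau>"
    using assms by (auto simp: trunc_tau_def split: if_splits)
  then show ?thesis by (simp add: trunc_tau_def theI')
qed

lemma trunc_tau_locally_analytic: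
  assumes "n > 1" "0 < b" "b < 1" and nonint: "trunc_tau \<Phi> T n b \<notin> \<int>"
  obtains r h where "r > 0" "h holomorphic_on ball (of_real b) r"
    "\<And>x. x \<in> {b - r<..<b + r} \<Longrightarrow> trunc_tau \<Phi> T n x = Re (h (of_real x))"
    "\<And>x. x \<in> {b - r<..<b + r} \<Longrightarrow> trunc_tau \<Phi> T n x \<notin> \<int>"
proof -
  define c where "c = trunc_tau \<Phi> T n b"
  have root: "is_trunc_root \<Phi> T n b c"
    using is_trunc_root_trunc_tau[OF nonint] by (simp add: c_def)
  then have "c > 0" by (simp add: is_trunc_root_def)
  define k where "k = nat \<lfloor>c\<rfloor>"
  have "c \<noteq> of_int \<lfloor>c\<rfloor>" using nonint unfolding c_def by (metis Ints_of_int)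
  then have kc: "of_nat k < c" "c < of_nat k + 1"
    using \<open>c > 0\<close> unfolding k_def by linarith+
  define A where "A = (\<Sum>j<k. fact j / ln n ^ j)"
  define B where "B = fact k / ln n ^ k"
  define C where "C = n / ln n"
  have pos: "B > 0" "C > 0" using \<open>n > 1\<close> by (simp_all add: B_def C_def)
  \<comment> \<open>\<open>P\<close> is \<open>septic_step\<close> on complex numbers, and
    \<open>p\<close> continues \<open>septic_li n\<close> from the open interval between k and k + 1
    that contains c.\<close>
  define P where "P w = 35 * w ^ 4 - 84 * w ^ 5 + 70 * w ^ 6 - 20 * w ^ 7" for w :: complex
  define p where "p w = of_real C * (of_real A + P (w - of_nat k) * of_real B)" for w
  have p_real: "p (of_real t) = of_real (septic_li n t)" if "of_nat k < t" "t < of_nat k + 1" for t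
    using septic_li_on_unit_interval[OF that, of n]
    by (simp add: p_def P_def septic_step_def A_def B_def C_def)
  have dP: "(P has_field_derivative 140 * (w * (1 - w)) ^ 3) (at w)" for w
    unfolding P_def [abs_def] by (rule derivative_eq_intros refl | simp)+ algebra
  have dp: "(p has_field_derivative of_real C * (140 * ((w - of_nat k) * (1 - (w - of_nat k))) ^ 3 * of_real B)) (at w)" for w
    unfolding p_def [abs_def]
    by (rule derivative_eq_intros refl DERIV_chain2[OF dP] | simp)+
  have "deriv p (of_real c) = of_real (C * (140 * ((c - of_nat k) * (1 - (c - of_nat k))) ^ 3 * B))"
    using DERIV_imp_deriv[OF dp[of "of_real c"]] by simp
  \<comment> \<open>The fractional part of c lies strictly between 0 and 1, away from the zeros of
    the derivative.\<close>
  moreover have "C * (140 * ((c - of_nat k) * (1 - (c - of_nat k))) ^ 3 * B) > 0"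
    using pos kc by simp
  ultimately have deriv_nz: "deriv p (of_real c) \<noteq> 0" by (metis of_real_eq_0_iff less_irrefl)
  have p_hol: "p holomorphic_on UNIV"
    unfolding p_def [abs_def] P_def by (intro holomorphic_intros)
  have p_cnj: "p (cnj z) = cnj (p z)" for z
    by (simp add: p_def P_def)
  have q_real: "truncated_R_ext \<Phi> T n (of_real x) \<in> \<real>" if "of_real x \<in> critical_strip" for x
    using that truncated_R_real[OF \<open>n > 1\<close>, of x]
    by (simp add: truncated_R_ext_of_real critical_strip_def)
  have b_strip: "of_real b \<in> critical_strip" using assms by (simp add: critical_strip_def)
  have eq: "truncated_R_ext \<Phi> T n (of_real b) = p (of_real c)"
    using root p_real[OF kc] by (simp add: truncated_R_ext_of_real is_trunc_root_def)
  obtain s h where s: "s > 0" "h holomorphic_on ball (of_real b) s"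
    and h: "h (of_real b) = of_real c"
      "\<And>z. z \<in> ball (of_real b) s \<Longrightarrow> p (h z) = truncated_R_ext \<Phi> T n z"
      "\<And>x. complex_of_real x \<in> ball (of_real b) s \<Longrightarrow> h (of_real x) \<in> \<real>"
    using real_holomorphic_inverse_branch[OF p_hol p_cnj deriv_nz
        truncated_R_ext_holomorphic[OF \<open>n > 1\<close>] open_critical_strip b_strip q_real eq] by metis
  \<comment> \<open>On the real points of this vertical strip \<open>p\<close> agrees with
    \<open>septic_li n\<close>. Shrinking the ball keeps h inside it, so the integer part of the
    root cannot change.\<close>
  define U where "U = {z. of_nat k < Re z} \<inter> {z. Re z < of_nat k + 1}"
  have "open U"
    unfolding U_def by (intro open_Int open_halfspace_Re_gt open_halfspace_Re_lt)
  then have "open (h -` U \<inter> ball (of_real b) s)"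
    using s(2) holomorphic_on_imp_continuous_on continuous_on_open_vimage[OF open_ball] by blast
  moreover have "of_real b \<in> h -` U \<inter> ball (of_real b) s"
    using h(1) kc s(1) by (simp add: U_def)
  ultimately obtain r where r: "r > 0" "ball (of_real b) r \<subseteq> h -` U \<inter> ball (of_real b) s"
    by (meson open_contains_ball)
  have main: "trunc_tau \<Phi> T n x = Re (h (of_real x)) \<and> of_nat k < Re (h (of_real x)) \<and>
      Re (h (of_real x)) < of_nat k + 1"
    if "x \<in> {b - r<..<b + r}" for x
  proof -
    have x: "of_real x \<in> ball (of_real b :: complex) r"
      using that by (auto simp: dist_real_def dist_of_real)
    define t where "t = Re (h (of_real x))"
    have t: "of_nat k < t" "t < of_nat k + 1" using subsetD[OF r(2) x] by (simp_all add: U_def t_def)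
    \<comment> \<open>Because h is real at real points, the complex equation for h becomes the root
      equation for t; uniqueness of the root then identifies t with
      \<open>trunc_tau\<close>.\<close>
    have "h (of_real x) = of_real t"
      using h(3) r(2) x unfolding t_def by (metis IntD2 of_real_Re subsetD)
    then have "complex_of_real (septic_li n t) = truncated_R \<Phi> T n x"
      using h(2)[of "of_real x"] subsetD[OF r(2) x] p_real[OF t] by (simp add: truncated_R_ext_of_real)
    then have "is_trunc_root \<Phi> T n x t"
      using t by (simp add: is_trunc_root_def)
    then show ?thesis using trunc_tau_eqI[OF \<open>n > 1\<close>] t by (simp add: t_def)
  qed
  show ?thesis
  proof
    show "r > 0" by fact
    show "h holomorphic_on ball (of_real b) r"
      using r(2) s(2) holomorphic_on_subset by blast
    show "trunc_tau \<Phi> T n x = Re (h (of_real x))" if "x \<in> {b - r<..<b + r}" for x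
      using main[OF that] by simp
    show "trunc_tau \<Phi> T n x \<notin> \<int>" if "x \<in> {b - r<..<b + r}" for x
    proof
      assume "trunc_tau \<Phi> T n x \<in> \<int>"
      then obtain z where "trunc_tau \<Phi> T n x = of_int z" by (rule Ints_cases)
      \<comment> \<open>An integer value would lie strictly between the consecutive integers k and k
        + 1.\<close>
      with main[OF that] have "of_int (int k) < (of_int z :: real)" "of_int z < (of_int (int k + 1) :: real)"
        by simp_all
      then show False by (simp only: of_int_less_iff)
    qed
  qed
qed

theorem theorem5p3:
  fixes n T \<epsilon> :: real and \<Phi> :: "real \<Rightarrow> real \<Rightarrow> real"
  assumes "n > 2" and "T > 0" and "\<epsilon> > 0" and "smooth_window \<epsilon> \<Phi>"
  shows "(\<forall>D. ((\<lambda>\<beta>. trunc_tau \<Phi> T n \<beta>) has_real_derivative D) (at (1 / 2)) \<longrightarrow> D = 0) \<and>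
    (trunc_tau \<Phi> T n (1 / 2) \<notin> \<int> \<longrightarrow>
      ((\<lambda>\<beta>. trunc_tau \<Phi> T n \<beta>) has_real_derivative 0) (at (1 / 2)) \<and>
      (\<exists>a b. 0 \<le> a \<and> a < 1 / 2 \<and> 1 / 2 < b \<and> b \<le> 1 \<and>
         (\<forall>\<beta>\<in>{a<..<b}. trunc_tau \<Phi> T n \<beta> \<notin> \<int>) \<and>
         smooth_on {a<..<b} (\<lambda>\<beta>. trunc_tau \<Phi> T n \<beta>)) \<and>
      (\<forall>m::nat. (deriv ^^ (2 * m + 1)) (\<lambda>\<beta>. trunc_tau \<Phi> T n \<beta>) (1 / 2) = 0))"
proof (intro conjI allI impI)
  let ?\<tau> = "\<lambda>\<beta>. trunc_tau \<Phi> T n \<beta>"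
  have sym: "?\<tau> (2 * (1 / 2) - x) = ?\<tau> x" for x
    using trunc_tau_symmetric by simp
  \<comment> \<open>This uses only the symmetry, so it also covers an integer value at 1/2.\<close>
  show "D = 0" if "(?\<tau> has_real_derivative D) (at (1 / 2))" for D
    using symmetric_derivative_zero[of ?\<tau>, OF sym that] .
  assume nonint: "?\<tau> (1 / 2) \<notin> \<int>"
  have "n > 1" using \<open>n > 2\<close> by simp
  have half: "0 < (1 / 2 :: real)" "(1 / 2 :: real) < 1" by simp_all
  obtain r h where r: "r > 0" "h holomorphic_on ball (of_real (1 / 2)) r"
    and eq: "\<And>x. x \<in> {1 / 2 - r<..<1 / 2 + r} \<Longrightarrow> ?\<tau> x = Re (h (of_real x))"
    and ni: "\<And>x. x \<in> {1 / 2 - r<..<1 / 2 + r} \<Longrightarrow> ?\<tau> x \<notin> \<int>"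
    using trunc_tau_locally_analytic[OF \<open>n > 1\<close> half nonint] by blast
  have smooth: "smooth_on {1 / 2 - r<..<1 / 2 + r} ?\<tau>"
  proof (rule smooth_on_Re_holomorphic[OF open_greaterThanLessThan open_ball r(2) _ eq])
    show "of_real x \<in> ball (of_real (1 / 2) :: complex) r" if "x \<in> {1 / 2 - r<..<1 / 2 + r}" for x
      using that by (auto simp only: mem_ball dist_of_real) (auto simp: dist_real_def)
  qed
  have odd0: "(deriv ^^ k) ?\<tau> (1 / 2) = 0" if "odd k" for k
    using odd_deriv_funpow_symmetric[of ?\<tau>, OF sym smooth r(1) that] .
  show "(deriv ^^ (2 * m + 1)) ?\<tau> (1 / 2) = 0" for m
    by (rule odd0) simp
  \<comment> \<open>Order 0 of \<open>smooth_on\<close> provides the derivative at 1/2; the odd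
    order 1 gives its value.\<close>
  have "?\<tau> differentiable (at (1 / 2))"
    using smooth r(1) unfolding smooth_on_def by (auto dest: spec[of _ 0])
  then show "(?\<tau> has_real_derivative 0) (at (1 / 2))"
    using odd0[of 1] by (simp add: DERIV_deriv_iff_real_differentiable[symmetric])
  \<comment> \<open>The cap 1/2 keeps the interval inside [0, 1].\<close>
  define d where "d = min r (1 / 2)"
  have sub: "{1 / 2 - d<..<1 / 2 + d} \<subseteq> {1 / 2 - r<..<1 / 2 + r}" by (auto simp: d_def)
  show "\<exists>a b. 0 \<le> a \<and> a < 1 / 2 \<and> 1 / 2 < b \<and> b \<le> 1 \<and>
      (\<forall>\<beta>\<in>{a<..<b}. ?\<tau> \<beta> \<notin> \<int>) \<and> smooth_on {a<..<b} ?\<tau>"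
  proof (intro exI conjI ballI)
    show "0 \<le> 1 / 2 - d" "1 / 2 - d < 1 / 2" "1 / 2 < 1 / 2 + d" "1 / 2 + d \<le> 1"
      using r(1) by (auto simp: d_def)
    show "?\<tau> \<beta> \<notin> \<int>" if "\<beta> \<in> {1 / 2 - d<..<1 / 2 + d}" for \<beta>
      using ni that sub by blast
    show "smooth_on {1 / 2 - d<..<1 / 2 + d} ?\<tau>"
      using smooth sub unfolding smooth_on_def by blast
  qed
qed

end
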